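(* Let $\mathcal F$ and $\mathcal G$ be two $\sigma$-algebras (sub-$\sigma$-algebras of the underlying probability space) and let $\epsilon\in[0,1]$ be such that, for all $A\in\mathcal F$ and $B\in\mathcal G$, with respective probabilities $p=\Pr[A]$ and $q=\Pr[B]$, $$\Pr[A\cap B]-pq\ \le\ \epsilon\sqrt{p(1-p)q(1-q)}.$$ Then $$\{\mathcal F:\mathcal G\}\ \le\ \Lambda(\epsilon),$$ where $\Lambda:[0,1]\to\mathbb R_+$ is defined by $\Lambda(\epsilon)=\epsilon(1+|\log\epsilon|)$ if $\epsilon>0$ and $\Lambda(0)=0$.
   Context: All $\sigma$-algebras are sub-$\sigma$-algebras of a probability space $(\Omega,\mathcal B,\Pr)$; $\log$ is the natural logarithm. The Hilbertian (maximal) correlation coefficient of $\mathcal F$ and $\mathcal G$ is $$\{\mathcal F:\mathcal G\}=\sup_{f,g}\frac{|\operatorname{Cov}(f,g)|}{\operatorname{sd}(f)\operatorname{sd}(g)},$$ the supremum being over real square-integrable, not a.s. constant $f$ ($\mathcal F$-measurable) and $g$ ($\mathcal G$-measurable), where $\operatorname{sd}$ denotes the standard deviation; it is $0$ if $\mathcal F$ or $\mathcal G$ is trivial. *)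

theory Defs
  imports "HOL-Probability.Probability"
begin

definition covariance :: "'a measure \<Rightarrow> ('a \<Rightarrow> real) \<Rightarrow> ('a \<Rightarrow> real) \<Rightarrow> real" where
  "covariance M f g =
     (\<integral>x. (f x - (\<integral>y. f y \<partial>M)) * (g x - (\<integral>y. g y \<partial>M)) \<partial>M)"

definition std_dev :: "'a measure \<Rightarrow> ('a \<Rightarrow> real) \<Rightarrow> real" where
  "std_dev M f = sqrt (prob_space.variance M f)"

definition ae_constant :: "'a measure \<Rightarrow> ('a \<Rightarrow> real) \<Rightarrow> bool" where
  "ae_constant M f \<longleftrightarrow> (\<exists>c. AE x in M. f x = c)"

(* The sigma-algebra is the family of sets of F; the measure is always that of M. *)
definition trivial_algebra :: "'a measure \<Rightarrow> 'a measure \<Rightarrow> bool" where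
  "trivial_algebra M F \<longleftrightarrow> (\<forall>A\<in>sets F. measure M A = 0 \<or> measure M A = 1)"

definition nonconst_L2 :: "'a measure \<Rightarrow> 'a measure \<Rightarrow> ('a \<Rightarrow> real) set" where
  "nonconst_L2 M F =
     {f \<in> borel_measurable F. integrable M (\<lambda>x. (f x)\<^sup>2) \<and> \<not> ae_constant M f}"

definition correlation_values :: "'a measure \<Rightarrow> 'a measure \<Rightarrow> 'a measure \<Rightarrow> real set" where
  "correlation_values M F G =
     {\<bar>covariance M f g\<bar> / (std_dev M f * std_dev M g) | f g.
        f \<in> nonconst_L2 M F \<and> g \<in> nonconst_L2 M G}"

(* The real supremum is a genuine one: for sub-sigma-algebras of a probability space the set
   of values is bounded above, and it is nonempty when neither sigma-algebra is trivial
   (both proved below). *)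
definition maximal_correlation :: "'a measure \<Rightarrow> 'a measure \<Rightarrow> 'a measure \<Rightarrow> real" where
  "maximal_correlation M F G =
     (if trivial_algebra M F \<or> trivial_algebra M G then 0 else Sup (correlation_values M F G))"

definition Lambda :: "real \<Rightarrow> real" where
  "Lambda \<epsilon> = (if \<epsilon> > 0 then \<epsilon> * (1 + \<bar>ln \<epsilon>\<bar>) else 0)"

lemma nonconst_L2_nonempty:
  assumes "prob_space M" and sub: "subalgebra M F" and nt: "\<not> trivial_algebra M F"
  shows "nonconst_L2 M F \<noteq> {}"
proof -
  interpret prob_space M by fact
  obtain A where A: "A \<in> sets F" and p: "measure M A \<noteq> 0" "measure M A \<noteq> 1"
    using nt by (auto simp: trivial_algebra_def)
  have AM: "A \<in> sets M"
    using A sub by (auto simp: subalgebra_def)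
  have "\<not> ae_constant M (indicator A)"
  proof
    assume "ae_constant M (indicator A)"
    then obtain c where c: "AE x in M. indicator A x = (c::real)"
      by (auto simp: ae_constant_def)
    show False
    proof (cases "c = 1")
      case True
      have "AE x in M. x \<in> A"
        using c by eventually_elim (auto simp: True indicator_def split: if_splits)
      then show False using prob_eq_1[OF AM] p by simp
    next
      case False
      have "AE x in M. x \<notin> A"
        using c by eventually_elim (use False in \<open>auto simp: indicator_def split: if_splits\<close>)
      then show False using prob_eq_0[OF AM] p by simp
    qed
  qed
  moreover have "integrable M (\<lambda>x. (indicator A x :: real)\<^sup>2)"
    using AM by (auto simp: power2_eq_square emeasure_eq_measure simp flip: indicator_inter_arith
        intro!: integrable_real_indicator)
  ultimately have "indicator A \<in> nonconst_L2 M F"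
    using A by (auto simp: nonconst_L2_def)
  then show ?thesis by blast
qed

lemma correlation_values_nonempty:
  assumes "prob_space M" "subalgebra M F" "subalgebra M G"
    and "\<not> trivial_algebra M F" "\<not> trivial_algebra M G"
  shows "correlation_values M F G \<noteq> {}"
  using nonconst_L2_nonempty[of M F] nonconst_L2_nonempty[of M G] assms
  by (fastforce simp: correlation_values_def)

lemma abs_covariance_le:
  assumes "prob_space M"
    and f: "f \<in> borel_measurable M" "integrable M (\<lambda>x. (f x)\<^sup>2)"
    and g: "g \<in> borel_measurable M" "integrable M (\<lambda>x. (g x)\<^sup>2)"
    and pos: "std_dev M f > 0" "std_dev M g > 0"
  shows "\<bar>covariance M f g\<bar> \<le> std_dev M f * std_dev M g"
proof -
  interpret prob_space M by fact
  define f0 where "f0 x = f x - expectation f" for x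
  define g0 where "g0 x = g x - expectation g" for x
  define a where "a = std_dev M f"
  define b where "b = std_dev M g"
  have ab: "a > 0" "b > 0"
    using pos by (simp_all add: a_def b_def)
  have [measurable]: "f0 \<in> borel_measurable M" "g0 \<in> borel_measurable M"
    using f g unfolding f0_def[abs_def] g0_def[abs_def] by measurable
  have i: "integrable M f" "integrable M g"
    using f g by (auto intro: square_integrable_imp_integrable)
  have i2: "integrable M (\<lambda>x. (f0 x)\<^sup>2)" "integrable M (\<lambda>x. (g0 x)\<^sup>2)"
    using f g i by (auto simp: f0_def g0_def power2_diff)
  have v: "expectation (\<lambda>x. (f0 x)\<^sup>2) = a\<^sup>2" "expectation (\<lambda>x. (g0 x)\<^sup>2) = b\<^sup>2"
    by (simp_all add: a_def b_def std_dev_def f0_def g0_def)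
  have amgm: "\<bar>u * w\<bar> \<le> b / (2 * a) * u\<^sup>2 + a / (2 * b) * w\<^sup>2" for u w :: real
  proof -
    have "2 * (\<bar>b * u\<bar> * \<bar>a * w\<bar>) \<le> (b * u)\<^sup>2 + (a * w)\<^sup>2"
      using sum_squares_bound[of "\<bar>b * u\<bar>" "\<bar>a * w\<bar>"] by simp
    moreover have "(2 * a * b) * (b / (2 * a) * u\<^sup>2 + a / (2 * b) * w\<^sup>2) = (b * u)\<^sup>2 + (a * w)\<^sup>2"
      using ab by (simp add: field_simps power2_eq_square)
    moreover have "2 * (\<bar>b * u\<bar> * \<bar>a * w\<bar>) = (2 * a * b) * \<bar>u * w\<bar>"
      using ab by (simp add: abs_mult)
    ultimately have "(2 * a * b) * \<bar>u * w\<bar> \<le> (2 * a * b) * (b / (2 * a) * u\<^sup>2 + a / (2 * b) * w\<^sup>2)"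
      by linarith
    then show ?thesis
      using ab by (simp only: mult_le_cancel_left_pos mult_pos_pos zero_less_numeral)
  qed
  have "\<bar>covariance M f g\<bar> = \<bar>expectation (\<lambda>x. f0 x * g0 x)\<bar>"
    by (simp add: covariance_def f0_def g0_def)
  also have "\<dots> \<le> expectation (\<lambda>x. \<bar>f0 x * g0 x\<bar>)"
    by (rule integral_abs_bound)
  also have "\<dots> \<le> expectation (\<lambda>x. b / (2 * a) * (f0 x)\<^sup>2 + a / (2 * b) * (g0 x)\<^sup>2)"
    using i2 ab by (intro integral_mono' amgm) auto
  also have "\<dots> = a * b"
    using i2 ab by (simp add: v) (simp add: power2_eq_square)
  finally show ?thesis
    by (simp add: a_def b_def)
qed

lemma bdd_above_correlation_values:
  assumes "prob_space M" "subalgebra M F" "subalgebra M G"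
  shows "bdd_above (correlation_values M F G)"
proof (rule bdd_aboveI[where M = 1])
  fix r assume "r \<in> correlation_values M F G"
  then obtain f g where r: "r = \<bar>covariance M f g\<bar> / (std_dev M f * std_dev M g)"
    and fg: "f \<in> nonconst_L2 M F" "g \<in> nonconst_L2 M G"
    by (auto simp: correlation_values_def)
  have nn: "std_dev M h \<ge> 0" for h
    by (simp add: std_dev_def)
  show "r \<le> 1"
  proof (cases "std_dev M f = 0 \<or> std_dev M g = 0")
    case False
    then have pos: "std_dev M f > 0" "std_dev M g > 0"
      using nn[of f] nn[of g] by simp_all
    have "\<bar>covariance M f g\<bar> \<le> std_dev M f * std_dev M g"
      using assms fg pos by (intro abs_covariance_le)
        (auto simp: nonconst_L2_def intro: measurable_from_subalg)
    then show ?thesis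
      using r pos by (simp add: divide_le_eq_1)
  qed (use r in auto)
qed

end

theory Submission
  imports Defs
begin

text \<open>For simple \<open>f\<close> and \<open>g\<close>, a layer-cake decomposition writes the covariance as a
  nonnegative combination of \<open>Pr[A \<inter> B] - p q\<close> with \<open>A = {f \<ge> v}\<close> and \<open>B = {g \<ge> w}\<close>. Besides the
  assumed bound there is the trivial one, \<open>min p q - p q = sqrt (p (1 - p) q (1 - q)) k (a - b)\<close>,
  where \<open>k s = exp (- \<bar>s\<bar> / 2)\<close> and \<open>a\<close>, \<open>b\<close> are the logits of \<open>p\<close>, \<open>q\<close>; for two level sets of the
  same function it is an equality, so that \<open>k\<close> computes the variances. The two bounds together give
  the kernel \<open>min \<epsilon> k\<close>. With \<open>T = 2 \<bar>log \<epsilon>\<bar>\<close> this is the convolution of \<open>k\<close> with the positive measure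
  \<open>\<epsilon> / 4 dh\<close> on \<open>[-T, T]\<close> plus masses \<open>\<epsilon> / 2\<close> at \<open>T\<close> and \<open>-T\<close>, whose total mass is \<open>\<Lambda> \<epsilon>\<close>. As \<open>k\<close> is
  positive definite and translation invariant, Cauchy--Schwarz under every shift \<open>h\<close> gives the factor
  \<open>\<Lambda> \<epsilon>\<close>. Square-integrable functions follow by dominated convergence.\<close>

section \<open>The exponential kernel and its truncation\<close>

text \<open>The translate by \<open>a\<close> of the one-sided exponential
  \<open>exp (- t / 2)\<close> on \<open>t \<ge> 0\<close>. Inner products of such translates in L2
  give the kernel, so that its positive definiteness becomes the nonnegativity of an integrated
  square.\<close>

definition half_exp :: "real \<Rightarrow> real \<Rightarrow> real" where
  "half_exp a t = exp (a / 2) * (if a \<le> t then exp (- t / 2) else 0)"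

text \<open>The product lives on \<open>t \<ge> max a b\<close>, and
  \<open>max a b - (a + b) / 2 = \<bar>a - b\<bar> / 2\<close>.\<close>

lemma has_integral_half_exp_mult:
  "((\<lambda>t. half_exp a t * half_exp b t) has_integral exp (- \<bar>a - b\<bar> / 2)) UNIV"
proof -
  have "((\<lambda>t::real. exp (- 1 * t)) has_integral exp (- 1 * max a b) / 1) {max a b..}"
    by (rule has_integral_exp_minus_to_infinity) simp
  then have "((\<lambda>t. exp ((a + b) / 2) * (if t \<in> {max a b..} then exp (- t) else 0)) has_integral
      exp ((a + b) / 2) * exp (- max a b)) UNIV"
    by (intro has_integral_mult_right) (simp only: has_integral_restrict_UNIV, simp)
  moreover have "exp ((a + b) / 2) * exp (- max a b) = exp (- \<bar>a - b\<bar> / 2)"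
    unfolding exp_add[symmetric] by (rule arg_cong[where f = exp]) (auto simp: max_def field_simps abs_if)
  moreover have "(\<lambda>t. exp ((a + b) / 2) * (if t \<in> {max a b..} then exp (- t) else 0)) =
      (\<lambda>t. half_exp a t * half_exp b t)"
  proof
    fix t :: real
    have "exp (- t) = exp (- t / 2) * exp (- t / 2)"
      by (simp flip: exp_add)
    moreover have "exp ((a + b) / 2) = exp (a / 2) * exp (b / 2)"
      by (simp add: add_divide_distrib flip: exp_add)
    ultimately show "exp ((a + b) / 2) * (if t \<in> {max a b..} then exp (- t) else 0) =
        half_exp a t * half_exp b t"
      by (auto simp: half_exp_def)
  qed
  ultimately show ?thesis by simp
qed

text \<open>Expand the nonnegative integral of \<open>(u t - v t)\<^sup>2\<close> for two
  combinations \<open>u\<close>, \<open>v\<close> of translates. This additive form of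
  Cauchy--Schwarz involves no square roots and can be averaged over shifts; the product form is
  recovered at the very end by normalising.\<close>

lemma exp_kernel_polarization:
  fixes x a :: "'i \<Rightarrow> real" and y b :: "'j \<Rightarrow> real"
  assumes "finite I" "finite J"
  shows "2 * (\<Sum>i\<in>I. \<Sum>j\<in>J. x i * y j * exp (- \<bar>a i - b j\<bar> / 2))
    \<le> (\<Sum>i\<in>I. \<Sum>j\<in>I. x i * x j * exp (- \<bar>a i - a j\<bar> / 2))
      + (\<Sum>i\<in>J. \<Sum>j\<in>J. y i * y j * exp (- \<bar>b i - b j\<bar> / 2))"
proof -
  define u where "u t = (\<Sum>i\<in>I. x i * half_exp (a i) t)" for t
  define v where "v t = (\<Sum>j\<in>J. y j * half_exp (b j) t)" for t
  \<comment> \<open>Polymorphic in both index types, because it is applied to the pairs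
    \<open>I, I\<close>, then \<open>I, J\<close>, then \<open>J, J\<close>.\<close>
  have prod: "((\<lambda>t. (\<Sum>i\<in>A. z i * half_exp (c i) t) * (\<Sum>j\<in>B. w j * half_exp (d j) t)) has_integral
      (\<Sum>i\<in>A. \<Sum>j\<in>B. z i * w j * exp (- \<bar>c i - d j\<bar> / 2))) UNIV"
    if "finite A" "finite B" for A :: "'k set" and B :: "'l set" and z c w d
  proof -
    have "((\<lambda>t. \<Sum>i\<in>A. \<Sum>j\<in>B. (z i * w j) * (half_exp (c i) t * half_exp (d j) t)) has_integral
      (\<Sum>i\<in>A. \<Sum>j\<in>B. z i * w j * exp (- \<bar>c i - d j\<bar> / 2))) UNIV"
      using that by (intro has_integral_sum has_integral_mult_right has_integral_half_exp_mult)
    then show ?thesis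
      by (simp add: sum_product mult_ac)
  qed
  have "((\<lambda>t. u t * u t - 2 * (u t * v t) + v t * v t) has_integral
      ((\<Sum>i\<in>I. \<Sum>j\<in>I. x i * x j * exp (- \<bar>a i - a j\<bar> / 2))
       - 2 * (\<Sum>i\<in>I. \<Sum>j\<in>J. x i * y j * exp (- \<bar>a i - b j\<bar> / 2))
       + (\<Sum>i\<in>J. \<Sum>j\<in>J. y i * y j * exp (- \<bar>b i - b j\<bar> / 2)))) UNIV"
    unfolding u_def v_def using assms
    by (intro has_integral_add has_integral_diff has_integral_mult_right prod)
  moreover have "0 \<le> u t * u t - 2 * (u t * v t) + v t * v t" for t
    using zero_le_power2[of "u t - v t"] by (simp add: power2_eq_square algebra_simps)
  ultimately have "0 \<le> (\<Sum>i\<in>I. \<Sum>j\<in>I. x i * x j * exp (- \<bar>a i - a j\<bar> / 2))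
       - 2 * (\<Sum>i\<in>I. \<Sum>j\<in>J. x i * y j * exp (- \<bar>a i - b j\<bar> / 2))
       + (\<Sum>i\<in>J. \<Sum>j\<in>J. y i * y j * exp (- \<bar>b i - b j\<bar> / 2))"
    by (rule has_integral_nonneg)
  then show ?thesis by simp
qed

lemma has_integral_exp_half:
  fixes l r s :: real
  assumes "l \<le> r"
  shows "((\<lambda>h. exp ((h - s) / 2)) has_integral 2 * exp ((r - s) / 2) - 2 * exp ((l - s) / 2)) {l..r}"
    and "((\<lambda>h. exp ((s - h) / 2)) has_integral 2 * exp ((s - l) / 2) - 2 * exp ((s - r) / 2)) {l..r}"
proof -
  show "((\<lambda>h. exp ((h - s) / 2)) has_integral 2 * exp ((r - s) / 2) - 2 * exp ((l - s) / 2)) {l..r}"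
    using assms
    by (intro fundamental_theorem_of_calculus)
      (auto intro!: derivative_eq_intros simp flip: has_real_derivative_iff_has_vector_derivative)
  have "((\<lambda>h. exp ((s - h) / 2)) has_integral - 2 * exp ((s - r) / 2) - (- 2 * exp ((s - l) / 2))) {l..r}"
    using assms
    by (intro fundamental_theorem_of_calculus)
      (auto intro!: derivative_eq_intros simp flip: has_real_derivative_iff_has_vector_derivative)
  then show "((\<lambda>h. exp ((s - h) / 2)) has_integral 2 * exp ((s - l) / 2) - 2 * exp ((s - r) / 2)) {l..r}"
    by simp
qed

text \<open>Moving the two boundary terms to the left and dividing by \<open>4 * exp (T / 2)\<close>
  yields the convolution identity for the truncated kernel: the point masses at \<open>T\<close> and
  \<open>-T\<close> compensate exactly for the ends of the integral.\<close>

lemma has_integral_exp_kernel: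
  fixes s T :: real
  assumes "0 \<le> T"
  shows "((\<lambda>h. exp (- \<bar>s - h\<bar> / 2)) has_integral
    4 * (exp (T / 2) * min (exp (- T / 2)) (exp (- \<bar>s\<bar> / 2)))
      - 2 * exp (- \<bar>s - T\<bar> / 2) - 2 * exp (- \<bar>s + T\<bar> / 2)) {-T..T}"
proof -
  have m: "exp (T / 2) * min (exp (- T / 2)) (exp (- \<bar>s\<bar> / 2)) = (if \<bar>s\<bar> \<le> T then 1 else exp ((T - \<bar>s\<bar>) / 2))"
    by (auto simp: min_def diff_divide_distrib simp flip: exp_add)
  \<comment> \<open>The integrand peaks at \<open>h = s\<close>. A peak inside the interval splits
    it into two exponential pieces; otherwise a single piece remains.\<close>
  consider "\<bar>s\<bar> \<le> T" | "s > T" | "s < - T" by linarith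
  then show ?thesis
  proof cases
    case 1
    have "((\<lambda>h. exp (- \<bar>s - h\<bar> / 2)) has_integral 2 * exp ((s - s) / 2) - 2 * exp ((- T - s) / 2)) {-T..s}"
      using 1 by (intro has_integral_eq[OF _ has_integral_exp_half(1)]) auto
    moreover have "((\<lambda>h. exp (- \<bar>s - h\<bar> / 2)) has_integral 2 * exp ((s - s) / 2) - 2 * exp ((s - T) / 2)) {s..T}"
      using 1 by (intro has_integral_eq[OF _ has_integral_exp_half(2)]) auto
    ultimately have "((\<lambda>h. exp (- \<bar>s - h\<bar> / 2)) has_integral (2 * exp ((s - s) / 2) - 2 * exp ((- T - s) / 2))
        + (2 * exp ((s - s) / 2) - 2 * exp ((s - T) / 2))) {-T..T}"
      using 1 by (intro has_integral_combine[of "-T" s T]) auto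
    then show ?thesis unfolding m using 1 by (simp add: algebra_simps)
  next
    case 2
    have "((\<lambda>h. exp (- \<bar>s - h\<bar> / 2)) has_integral 2 * exp ((T - s) / 2) - 2 * exp ((- T - s) / 2)) {-T..T}"
      using 2 assms by (intro has_integral_eq[OF _ has_integral_exp_half(1)]) auto
    then show ?thesis unfolding m using 2 assms by (simp add: algebra_simps)
  next
    case 3
    have "((\<lambda>h. exp (- \<bar>s - h\<bar> / 2)) has_integral 2 * exp ((s - - T) / 2) - 2 * exp ((s - T) / 2)) {-T..T}"
      using 3 assms by (intro has_integral_eq[OF _ has_integral_exp_half(2)]) auto
    then show ?thesis unfolding m using 3 assms by (simp add: algebra_simps)
  qed
qed

text \<open>The truncated form is an average of the forms \<open>B h\<close> with total weight
  \<open>Lambda \<epsilon>\<close>, and polarization bounds each \<open>2 * B h\<close> by the same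
  quantity \<open>Q\<close>.\<close>

lemma truncated_exp_kernel_le:
  fixes x a :: "'i \<Rightarrow> real" and y b :: "'j \<Rightarrow> real"
  assumes fin: "finite I" "finite J" and \<epsilon>: "0 \<le> \<epsilon>" "\<epsilon> \<le> 1"
  shows "2 * (\<Sum>i\<in>I. \<Sum>j\<in>J. x i * y j * min \<epsilon> (exp (- \<bar>a i - b j\<bar> / 2)))
    \<le> Lambda \<epsilon> * ((\<Sum>i\<in>I. \<Sum>j\<in>I. x i * x j * exp (- \<bar>a i - a j\<bar> / 2))
      + (\<Sum>i\<in>J. \<Sum>j\<in>J. y i * y j * exp (- \<bar>b i - b j\<bar> / 2)))"
proof (cases "\<epsilon> = 0")
  \<comment> \<open>Here the truncation point would be infinite, but both sides are 0.\<close>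
  case True
  then show ?thesis by (simp add: Lambda_def min_def)
next
  case False
  \<comment> \<open>The distance at which the kernel has decayed to
    \<open>\<epsilon>\<close>.\<close>
  define T where "T = - 2 * ln \<epsilon>"
  have T: "0 \<le> T" and eT: "exp (- T / 2) = \<epsilon>" "exp (T / 2) = 1 / \<epsilon>"
    using \<epsilon> False by (auto simp: T_def exp_minus field_simps)
  define Q where "Q = (\<Sum>i\<in>I. \<Sum>j\<in>I. x i * x j * exp (- \<bar>a i - a j\<bar> / 2))
      + (\<Sum>i\<in>J. \<Sum>j\<in>J. y i * y j * exp (- \<bar>b i - b j\<bar> / 2))"
  define B where "B h = (\<Sum>i\<in>I. \<Sum>j\<in>J. x i * y j * exp (- \<bar>a i - b j - h\<bar> / 2))" for h
  define S where "S = (\<Sum>i\<in>I. \<Sum>j\<in>J. x i * y j * min \<epsilon> (exp (- \<bar>a i - b j\<bar> / 2)))"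
  \<comment> \<open>Shifting every \<open>b j\<close> by \<open>h\<close> leaves their mutual
    differences, hence \<open>Q\<close>, unchanged.\<close>
  have B: "2 * B h \<le> Q" for h
    using exp_kernel_polarization[OF fin, of x y a "\<lambda>j. b j + h"]
    by (simp add: Q_def B_def algebra_simps)
  have "(B has_integral (\<Sum>i\<in>I. \<Sum>j\<in>J. x i * y j *
      (4 * (1 / \<epsilon> * min \<epsilon> (exp (- \<bar>a i - b j\<bar> / 2)))
        - 2 * exp (- \<bar>a i - b j - T\<bar> / 2) - 2 * exp (- \<bar>a i - b j + T\<bar> / 2)))) {-T..T}"
    unfolding B_def using fin has_integral_exp_kernel[OF T, unfolded eT]
    by (intro has_integral_sum has_integral_mult_right) auto
  also have "(\<Sum>i\<in>I. \<Sum>j\<in>J. x i * y j *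
      (4 * (1 / \<epsilon> * min \<epsilon> (exp (- \<bar>a i - b j\<bar> / 2)))
        - 2 * exp (- \<bar>a i - b j - T\<bar> / 2) - 2 * exp (- \<bar>a i - b j + T\<bar> / 2)))
      = 4 / \<epsilon> * S - 2 * B T - 2 * B (- T)"
    by (simp add: S_def B_def sum_distrib_left sum_subtractf right_diff_distrib mult_ac)
  \<comment> \<open>The integrand is at most \<open>Q / 2\<close> on an interval of length
    \<open>2 * T\<close>. Afterwards the two boundary terms add at most \<open>2 * Q\<close>, which
    gives the factor \<open>2 + T\<close>.\<close>
  finally have "4 / \<epsilon> * S - 2 * B T - 2 * B (- T) \<le> Q / 2 * (2 * T)"
    by (rule has_integral_le)
      (use B T has_integral_const_real[of "Q / 2" "-T" T] in \<open>auto simp: mult_ac field_simps\<close>)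
  then have "4 / \<epsilon> * S \<le> Q * (2 + T)"
    using B[of T] B[of "- T"] by (simp add: algebra_simps)
  then have "2 * S \<le> \<epsilon> * (1 + T / 2) * Q"
    using \<epsilon> False by (simp add: field_simps)
  moreover have "\<epsilon> * (1 + T / 2) = Lambda \<epsilon>"
    using \<epsilon> False by (simp add: Lambda_def T_def)
  ultimately show ?thesis
    by (simp add: S_def Q_def)
qed

section \<open>Logits and layer-cake weights\<close>

text \<open>For \<open>p \<le> q\<close> the left side is \<open>p * (1 - q)\<close>. Its square is
  \<open>p * (1 - p) * q * (1 - q)\<close> times the odds ratio, and the square root of that ratio
  is the exponential of half the difference of logits.\<close>

lemma min_minus_mult_eq_exp_logit:
  fixes p q :: real
  assumes "0 \<le> p" "p \<le> 1" "0 \<le> q" "q \<le> 1"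
  shows "min p q - p * q = sqrt (p * (1 - p)) * sqrt (q * (1 - q))
    * exp (- \<bar>ln (p / (1 - p)) - ln (q / (1 - q))\<bar> / 2)"
proof -
  have *: "p * (1 - q) = sqrt (p * (1 - p)) * sqrt (q * (1 - q))
    * exp (- \<bar>ln (p / (1 - p)) - ln (q / (1 - q))\<bar> / 2)"
    if pq: "0 < p" "p \<le> q" "q < 1" for p q :: real
  proof -
    have le: "p / (1 - p) \<le> q / (1 - q)"
      using pq by (intro frac_le) auto
    have pos: "0 < p / (1 - p)" "0 < q / (1 - q)"
      using pq by auto
    then have "ln (p / (1 - p)) \<le> ln (q / (1 - q))"
      using le by simp
    then have e: "- \<bar>ln (p / (1 - p)) - ln (q / (1 - q))\<bar> / 2 = ln ((p / (1 - p)) / (q / (1 - q))) / 2"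
      using ln_divide_pos[OF pos] by simp
    have "exp (ln ((p / (1 - p)) / (q / (1 - q))) / 2) = sqrt ((p / (1 - p)) / (q / (1 - q)))"
      using divide_pos_pos[OF pos] by (simp only: exp_ln real_sqrt_gt_0_iff flip: ln_sqrt)
    then have "sqrt (p * (1 - p)) * sqrt (q * (1 - q)) * exp (- \<bar>ln (p / (1 - p)) - ln (q / (1 - q))\<bar> / 2)
      = sqrt ((p * (1 - p)) * (q * (1 - q)) * ((p / (1 - p)) / (q / (1 - q))))"
      unfolding e by (simp only: real_sqrt_mult)
    also have "(p * (1 - p)) * (q * (1 - q)) * ((p / (1 - p)) / (q / (1 - q))) = (p * (1 - q))\<^sup>2"
      using pq by (simp add: field_simps power2_eq_square)
    also have "sqrt ((p * (1 - q))\<^sup>2) = p * (1 - q)"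
      using pq by simp
    finally show ?thesis by simp
  qed
  \<comment> \<open>If \<open>p\<close> or \<open>q\<close> is 0 or 1, a square root vanishes and the junk value of the logit is harmless.\<close>
  consider "p = 0 \<or> p = 1 \<or> q = 0 \<or> q = 1" | "0 < p" "p \<le> q" "q < 1" | "0 < q" "q \<le> p" "p < 1"
    using assms by argo
  then show ?thesis
  proof cases
    case 1
    then show ?thesis using assms by (auto simp: min_def)
  next
    case 2
    then show ?thesis using *[OF 2] by (simp add: min_def algebra_simps)
  next
    case 3
    then show ?thesis using *[OF 3] by (auto simp: min_def algebra_simps abs_minus_commute)
  qed
qed

text \<open>Take \<open>c\<close> to be the least element and the weights to be the gaps between
  successive elements. The nonnegativity of the weights is what later permits bounding a covariance
  term by term.\<close>

lemma layer_decomposition: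
  fixes V :: "real set"
  assumes "finite V"
  shows "\<exists>c \<alpha>. (\<forall>v. 0 \<le> \<alpha> v) \<and> (\<forall>x\<in>V. x = c + (\<Sum>v\<in>V. \<alpha> v * of_bool (v \<le> x)))"
  using assms
proof (induction V rule: finite_linorder_max_induct)
  case empty
  show ?case by (auto intro!: exI[of _ "\<lambda>_. 0"])
next
  case (insert b A)
  then obtain c \<alpha> where \<alpha>: "\<And>v. 0 \<le> \<alpha> v" "\<And>x. x \<in> A \<Longrightarrow> x = c + (\<Sum>v\<in>A. \<alpha> v * of_bool (v \<le> x))"
    by blast
  have b: "b \<notin> A" using insert by auto
  show ?case
  proof (cases "A = {}")
    case True
    then show ?thesis by (auto intro!: exI[of _ b] exI[of _ "\<lambda>_. 0"])
  next
    case False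
    \<comment> \<open>The gap below the new maximum: \<open>c + sum \<alpha> A\<close> turns out to
      be \<open>Max A\<close>, since every level of \<open>A\<close> is reached there.\<close>
    define d where "d = b - (c + sum \<alpha> A)"
    have "Max A = c + (\<Sum>v\<in>A. \<alpha> v * of_bool (v \<le> Max A))"
      using insert False by (intro \<alpha>(2)) auto
    also have "(\<Sum>v\<in>A. \<alpha> v * of_bool (v \<le> Max A)) = sum \<alpha> A"
      using insert by (intro sum.cong) auto
    finally have "c + sum \<alpha> A \<in> A"
      using insert False Max_in[of A] by simp
    then have d: "0 \<le> d"
      using insert by (auto simp: d_def less_imp_le)
    have eq: "(\<Sum>v\<in>insert b A. (\<alpha>(b := d)) v * of_bool (v \<le> x)) =
        d * of_bool (b \<le> x) + (\<Sum>v\<in>A. \<alpha> v * of_bool (v \<le> x))" for x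
    proof -
      have "(\<Sum>v\<in>A. (\<alpha>(b := d)) v * of_bool (v \<le> x)) = (\<Sum>v\<in>A. \<alpha> v * of_bool (v \<le> x))"
        using b by (intro sum.cong) auto
      then show ?thesis using insert b by simp
    qed
    have "(\<Sum>v\<in>A. \<alpha> v * of_bool (v \<le> b)) = sum \<alpha> A"
      using insert by (intro sum.cong) (auto simp: less_imp_le)
    then have "b = c + (\<Sum>v\<in>insert b A. (\<alpha>(b := d)) v * of_bool (v \<le> b))"
      unfolding eq by (simp add: d_def)
    moreover have "x = c + (\<Sum>v\<in>insert b A. (\<alpha>(b := d)) v * of_bool (v \<le> x))" if "x \<in> A" for x
      unfolding eq using \<alpha>(2)[OF that] insert that by (auto simp: not_le)
    ultimately show ?thesis
      using d \<alpha>(1) by (intro exI[of _ c] exI[of _ "\<alpha>(b := d)"]) auto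
  qed
qed

section \<open>Covariance bound for simple functions\<close>

context prob_space
begin

text \<open>Bilinearity, with the constants \<open>c\<close> and \<open>d\<close> cancelled by
  centring. It serves both for the pair of functions and for each function with itself.\<close>

lemma covariance_layer_sums:
  fixes S :: "real \<Rightarrow> 'a set" and T :: "real \<Rightarrow> 'a set"
  assumes fin: "finite I" "finite J"
    and S: "\<And>v. v \<in> I \<Longrightarrow> S v \<in> events" and T: "\<And>w. w \<in> J \<Longrightarrow> T w \<in> events"
    and f: "\<And>x. x \<in> space M \<Longrightarrow> f x = c + (\<Sum>v\<in>I. \<alpha> v * indicator (S v) x)"
    and g: "\<And>x. x \<in> space M \<Longrightarrow> g x = d + (\<Sum>w\<in>J. \<beta> w * indicator (T w) x)"
  shows "covariance M f g =
    (\<Sum>v\<in>I. \<Sum>w\<in>J. \<alpha> v * \<beta> w * (prob (S v \<inter> T w) - prob (S v) * prob (T w)))"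
proof -
  have int: "integrable M (indicator (A) :: 'a \<Rightarrow> real)" if "A \<in> events" for A
    using that by (simp add: emeasure_eq_measure)
  have Ef: "expectation f = c + (\<Sum>v\<in>I. \<alpha> v * prob (S v))"
  proof -
    have "expectation f = expectation (\<lambda>x. c + (\<Sum>v\<in>I. \<alpha> v * indicator (S v) x))"
      using f by (rule Bochner_Integration.integral_cong[OF refl])
    also have "\<dots> = c + (\<Sum>v\<in>I. \<alpha> v * prob (S v))"
      using S int by (simp add: prob_space integral_sum)
    finally show ?thesis .
  qed
  have Eg: "expectation g = d + (\<Sum>w\<in>J. \<beta> w * prob (T w))"
  proof -
    have "expectation g = expectation (\<lambda>x. d + (\<Sum>w\<in>J. \<beta> w * indicator (T w) x))"
      using g by (rule Bochner_Integration.integral_cong[OF refl])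
    also have "\<dots> = d + (\<Sum>w\<in>J. \<beta> w * prob (T w))"
      using T int by (simp add: prob_space integral_sum)
    finally show ?thesis .
  qed
  have ind: "expectation (\<lambda>x. (indicator A x - prob A) * (indicator B x - prob B)) = prob (A \<inter> B) - prob A * prob B"
    "integrable M (\<lambda>x. (indicator A x - prob A) * (indicator B x - prob B))"
    if "A \<in> events" "B \<in> events" for A B
  proof -
    have eq: "(indicator A x - prob A) * (indicator B x - prob B) =
        indicator (A \<inter> B) x - prob B * indicator A x - prob A * indicator B x + prob A * prob B" for x
      by (simp add: indicator_inter_arith algebra_simps)
    have i: "integrable M (indicator A :: 'a \<Rightarrow> real)" "integrable M (indicator B :: 'a \<Rightarrow> real)"
      "integrable M (indicator (A \<inter> B) :: 'a \<Rightarrow> real)"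
      using that by (auto intro: int)
    show "expectation (\<lambda>x. (indicator A x - prob A) * (indicator B x - prob B)) = prob (A \<inter> B) - prob A * prob B"
      unfolding eq using i that by (simp add: prob_space)
    show "integrable M (\<lambda>x. (indicator A x - prob A) * (indicator B x - prob B))"
      unfolding eq using i by simp
  qed
  have "covariance M f g = expectation (\<lambda>x. \<Sum>v\<in>I. \<Sum>w\<in>J. \<alpha> v * \<beta> w *
      ((indicator (S v) x - prob (S v)) * (indicator (T w) x - prob (T w))))"
    unfolding covariance_def
  proof (rule Bochner_Integration.integral_cong[OF refl])
    fix x assume "x \<in> space M"
    then have "f x - expectation f = (\<Sum>v\<in>I. \<alpha> v * (indicator (S v) x - prob (S v)))"
      "g x - expectation g = (\<Sum>w\<in>J. \<beta> w * (indicator (T w) x - prob (T w)))"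
      by (simp_all add: f g Ef Eg sum_subtractf right_diff_distrib)
    then show "(f x - expectation f) * (g x - expectation g) = (\<Sum>v\<in>I. \<Sum>w\<in>J. \<alpha> v * \<beta> w *
      ((indicator (S v) x - prob (S v)) * (indicator (T w) x - prob (T w))))"
      by (simp add: sum_product mult_ac)
  qed
  also have "\<dots> = (\<Sum>v\<in>I. \<Sum>w\<in>J. \<alpha> v * \<beta> w * (prob (S v \<inter> T w) - prob (S v) * prob (T w)))"
  proof -
    have "integrable M (\<lambda>x. \<alpha> v * \<beta> w * ((indicator (S v) x - prob (S v)) * (indicator (T w) x - prob (T w))))"
      if "v \<in> I" "w \<in> J" for v w
      using that S T by (intro integrable_mult_right ind)
    then show ?thesis
      using S T by (simp add: Bochner_Integration.integral_sum ind)
  qed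
  finally show ?thesis .
qed

text \<open>Upper level sets of one function are nested, so their intersection has the smaller of
  the two probabilities.\<close>

lemma prob_nested_diff_eq_exp_logit:
  fixes f :: "'a \<Rightarrow> real"
  assumes "f \<in> borel_measurable M"
  defines "p \<equiv> \<lambda>v. prob {x \<in> space M. v \<le> f x}"
  shows "prob ({x \<in> space M. v \<le> f x} \<inter> {x \<in> space M. w \<le> f x}) - p v * p w =
    sqrt (p v * (1 - p v)) * sqrt (p w * (1 - p w))
      * exp (- \<bar>ln (p v / (1 - p v)) - ln (p w / (1 - p w))\<bar> / 2)"
proof -
  have anti: "p w \<le> p v" if "v \<le> w" for v w
    unfolding p_def using that assms(1) by (intro finite_measure_mono) auto
  have "{x \<in> space M. v \<le> f x} \<inter> {x \<in> space M. w \<le> f x} = {x \<in> space M. max v w \<le> f x}"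
    by auto
  then have "prob ({x \<in> space M. v \<le> f x} \<inter> {x \<in> space M. w \<le> f x}) = p (max v w)"
    by (simp add: p_def)
  also have "\<dots> = min (p v) (p w)"
    using anti[of v w] anti[of w v] by (auto simp: max_def min_def)
  finally show ?thesis
    by (simp add: min_minus_mult_eq_exp_logit p_def)
qed

text \<open>The covariance is bounded layer by layer through the truncated kernel, whereas the
  variances equal the corresponding forms in the full kernel. The kernel inequality then compares
  the two.\<close>

lemma covariance_simple_le:
  assumes sub: "subalgebra M F" "subalgebra M G" and \<epsilon>: "0 \<le> \<epsilon>" "\<epsilon> \<le> 1"
    and dep: "\<And>A B. A \<in> sets F \<Longrightarrow> B \<in> sets G \<Longrightarrow>
           prob (A \<inter> B) - prob A * prob B
             \<le> \<epsilon> * sqrt (prob A * (1 - prob A) * prob B * (1 - prob B))"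
    and f: "simple_function F (f :: 'a \<Rightarrow> real)" and g: "simple_function G (g :: 'a \<Rightarrow> real)"
  shows "2 * covariance M f g \<le> Lambda \<epsilon> * (covariance M f f + covariance M g g)"
proof -
  have sp: "space F = space M" "space G = space M"
    using sub by (auto simp: subalgebra_def)
  have setsD: "A \<in> sets F \<Longrightarrow> A \<in> events" "A \<in> sets G \<Longrightarrow> A \<in> events" for A
    using sub by (auto simp: subalgebra_def)
  have meas: "f \<in> borel_measurable F" "g \<in> borel_measurable G"
    using f g by (auto intro: borel_measurable_simple_function)
  then have measM: "f \<in> borel_measurable M" "g \<in> borel_measurable M"
    using sub by (auto intro: measurable_from_subalg)
  define I where "I = f ` space M"
  define J where "J = g ` space M"
  have fin: "finite I" "finite J"
    using f g by (auto simp: I_def J_def sp simple_function_def)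
  define S where "S v = {x \<in> space M. v \<le> f x}" for v
  define T where "T w = {x \<in> space M. w \<le> g x}" for w
  have SF: "S v \<in> sets F" and TG: "T v \<in> sets G" for v
    proof -
    have "{x \<in> space F. v \<le> f x} \<in> sets F" "{x \<in> space G. v \<le> g x} \<in> sets G"
      using meas by measurable
    then show "S v \<in> sets F" "T v \<in> sets G"
      by (simp_all add: S_def T_def sp)
  qed
  note ev = setsD(1)[OF SF] setsD(2)[OF TG]
  obtain c \<alpha> where \<alpha>: "\<And>v. 0 \<le> \<alpha> v" and fI: "\<And>x. x \<in> I \<Longrightarrow> x = c + (\<Sum>v\<in>I. \<alpha> v * of_bool (v \<le> x))"
    using layer_decomposition[OF fin(1)] by blast
  obtain d \<beta> where \<beta>: "\<And>v. 0 \<le> \<beta> v" and gJ: "\<And>x. x \<in> J \<Longrightarrow> x = d + (\<Sum>v\<in>J. \<beta> v * of_bool (v \<le> x))"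
    using layer_decomposition[OF fin(2)] by blast
  have f_eq: "f x = c + (\<Sum>v\<in>I. \<alpha> v * indicator (S v) x)" if "x \<in> space M" for x
    using fI[of "f x"] that by (simp add: I_def S_def indicator_def of_bool_def)
  have g_eq: "g x = d + (\<Sum>v\<in>J. \<beta> v * indicator (T v) x)" if "x \<in> space M" for x
    using gJ[of "g x"] that by (simp add: J_def T_def indicator_def of_bool_def)
  \<comment> \<open>The standard deviation of the indicator of an event, and the logit of its
    probability.\<close>
  define \<sigma> where "\<sigma> A = sqrt (prob A * (1 - prob A))" for A
  define \<eta> where "\<eta> A = ln (prob A / (1 - prob A))" for A
  have \<sigma>: "0 \<le> \<sigma> A" for A
    by (simp add: \<sigma>_def)
  \<comment> \<open>Monotonicity of the probability supplies the exponential, the dependence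
    hypothesis supplies \<open>\<epsilon>\<close>; both come with the same factor
    \<open>\<sigma> (S v) * \<sigma> (T w)\<close>.\<close>
  have fg: "prob (S v \<inter> T w) - prob (S v) * prob (T w)
      \<le> \<sigma> (S v) * \<sigma> (T w) * min \<epsilon> (exp (- \<bar>\<eta> (S v) - \<eta> (T w)\<bar> / 2))" for v w
  proof -
    have "prob (S v \<inter> T w) \<le> min (prob (S v)) (prob (T w))"
      using ev by (auto intro!: finite_measure_mono)
    then have "prob (S v \<inter> T w) - prob (S v) * prob (T w) \<le> min (prob (S v)) (prob (T w)) - prob (S v) * prob (T w)"
      by (rule diff_right_mono)
    also have "\<dots> = \<sigma> (S v) * \<sigma> (T w) * exp (- \<bar>\<eta> (S v) - \<eta> (T w)\<bar> / 2)"
      unfolding \<sigma>_def \<eta>_def by (rule min_minus_mult_eq_exp_logit) simp_all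
    finally have "prob (S v \<inter> T w) - prob (S v) * prob (T w)
        \<le> \<sigma> (S v) * \<sigma> (T w) * exp (- \<bar>\<eta> (S v) - \<eta> (T w)\<bar> / 2)" .
    moreover have "prob (S v \<inter> T w) - prob (S v) * prob (T w) \<le> \<sigma> (S v) * \<sigma> (T w) * \<epsilon>"
      using dep[OF SF TG, of v w] by (simp add: \<sigma>_def real_sqrt_mult mult_ac)
    ultimately show ?thesis
      by (simp add: min_def)
  qed
  have "2 * covariance M f g = 2 * (\<Sum>v\<in>I. \<Sum>w\<in>J. \<alpha> v * \<beta> w *
      (prob (S v \<inter> T w) - prob (S v) * prob (T w)))"
    using covariance_layer_sums[OF fin _ _ f_eq g_eq] ev by simp
  also have "\<dots> \<le> 2 * (\<Sum>v\<in>I. \<Sum>w\<in>J. \<alpha> v * \<beta> w *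
      (\<sigma> (S v) * \<sigma> (T w) * min \<epsilon> (exp (- \<bar>\<eta> (S v) - \<eta> (T w)\<bar> / 2))))"
    using \<alpha> \<beta> by (intro mult_left_mono sum_mono fg) auto
  also have "\<dots> = 2 * (\<Sum>v\<in>I. \<Sum>w\<in>J. (\<alpha> v * \<sigma> (S v)) * (\<beta> w * \<sigma> (T w)) *
      min \<epsilon> (exp (- \<bar>\<eta> (S v) - \<eta> (T w)\<bar> / 2)))"
    by (simp add: mult_ac)
  also have "\<dots> \<le> Lambda \<epsilon> *
      ((\<Sum>v\<in>I. \<Sum>w\<in>I. (\<alpha> v * \<sigma> (S v)) * (\<alpha> w * \<sigma> (S w)) * exp (- \<bar>\<eta> (S v) - \<eta> (S w)\<bar> / 2))
      + (\<Sum>v\<in>J. \<Sum>w\<in>J. (\<beta> v * \<sigma> (T v)) * (\<beta> w * \<sigma> (T w)) * exp (- \<bar>\<eta> (T v) - \<eta> (T w)\<bar> / 2)))"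
    using fin \<epsilon> by (rule truncated_exp_kernel_le)
  \<comment> \<open>Equality matters here: the form stands on the larger side, so an upper bound for
    the variance by it would not suffice.\<close>
  also have "(\<Sum>v\<in>I. \<Sum>w\<in>I. (\<alpha> v * \<sigma> (S v)) * (\<alpha> w * \<sigma> (S w)) * exp (- \<bar>\<eta> (S v) - \<eta> (S w)\<bar> / 2))
      = covariance M f f"
    using covariance_layer_sums[OF fin(1) fin(1) _ _ f_eq f_eq] ev(1)
      prob_nested_diff_eq_exp_logit[OF measM(1), folded S_def]
    by (simp add: \<sigma>_def \<eta>_def mult_ac)
  also have "(\<Sum>v\<in>J. \<Sum>w\<in>J. (\<beta> v * \<sigma> (T v)) * (\<beta> w * \<sigma> (T w)) * exp (- \<bar>\<eta> (T v) - \<eta> (T w)\<bar> / 2))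
      = covariance M g g"
    using covariance_layer_sums[OF fin(2) fin(2) _ _ g_eq g_eq] ev(2)
      prob_nested_diff_eq_exp_logit[OF measM(2), folded T_def]
    by (simp add: \<sigma>_def \<eta>_def mult_ac)
  finally show ?thesis .
qed

section \<open>Passage to square-integrable functions\<close>

lemma covariance_eq_expectation:
  assumes "integrable M f" "integrable M g" "integrable M (\<lambda>x. f x * g x)"
  shows "covariance M f g = expectation (\<lambda>x. f x * g x) - expectation f * expectation g"
proof -
  have "(f x - expectation f) * (g x - expectation g) =
      f x * g x - expectation g * f x - expectation f * g x + expectation f * expectation g" for x
    by (simp add: algebra_simps)
  then show ?thesis
    unfolding covariance_def using assms by (simp add: prob_space)
qed

lemma integrable_mult_square_integrable:
  fixes f g :: "'a \<Rightarrow> real"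
  assumes [measurable]: "f \<in> borel_measurable M" "g \<in> borel_measurable M"
    and "integrable M (\<lambda>x. (f x)\<^sup>2)" "integrable M (\<lambda>x. (g x)\<^sup>2)"
  shows "integrable M (\<lambda>x. f x * g x)"
proof (rule Bochner_Integration.integrable_bound)
  show "integrable M (\<lambda>x. (f x)\<^sup>2 + (g x)\<^sup>2)"
    using assms by simp
  show "AE x in M. norm (f x * g x) \<le> norm ((f x)\<^sup>2 + (g x)\<^sup>2)"
  proof (rule AE_I2)
    fix x
    have "2 * (\<bar>f x\<bar> * \<bar>g x\<bar>) \<le> (f x)\<^sup>2 + (g x)\<^sup>2"
      using sum_squares_bound[of "\<bar>f x\<bar>" "\<bar>g x\<bar>"] by simp
    moreover have "0 \<le> \<bar>f x\<bar> * \<bar>g x\<bar>" by simp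
    ultimately show "norm (f x * g x) \<le> norm ((f x)\<^sup>2 + (g x)\<^sup>2)"
      unfolding real_norm_def abs_mult by linarith
  qed
qed measurable

text \<open>Dominated convergence for the two means and the mean of the product, with dominating
  functions \<open>2 * \<bar>f x\<bar>\<close>, \<open>2 * \<bar>g x\<bar>\<close> and
  \<open>4 * \<bar>f x * g x\<bar>\<close>.\<close>

lemma covariance_tendsto:
  fixes f g :: "'a \<Rightarrow> real"
  assumes meas: "f \<in> borel_measurable M" "g \<in> borel_measurable M"
    "\<And>n. s n \<in> borel_measurable M" "\<And>n. t n \<in> borel_measurable M"
    and sq: "integrable M (\<lambda>x. (f x)\<^sup>2)" "integrable M (\<lambda>x. (g x)\<^sup>2)"
    and s: "\<And>x. x \<in> space M \<Longrightarrow> (\<lambda>n. s n x) \<longlonglongrightarrow> f x" "\<And>n x. x \<in> space M \<Longrightarrow> \<bar>s n x\<bar> \<le> 2 * \<bar>f x\<bar>"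
    and t: "\<And>x. x \<in> space M \<Longrightarrow> (\<lambda>n. t n x) \<longlonglongrightarrow> g x" "\<And>n x. x \<in> space M \<Longrightarrow> \<bar>t n x\<bar> \<le> 2 * \<bar>g x\<bar>"
  shows "(\<lambda>n. covariance M (s n) (t n)) \<longlonglongrightarrow> covariance M f g"
proof -
  note [measurable] = meas
  have i: "integrable M f" "integrable M g"
    using meas sq by (auto intro: square_integrable_imp_integrable)
  have fg: "integrable M (\<lambda>x. f x * g x)"
    using meas sq by (intro integrable_mult_square_integrable)
  have st: "\<bar>s n x * t n x\<bar> \<le> 4 * \<bar>f x * g x\<bar>" if "x \<in> space M" for n x
    using mult_mono[OF s(2)[OF that, of n] t(2)[OF that, of n]] by (simp add: abs_mult)
  have w: "integrable M (\<lambda>x. 2 * \<bar>f x\<bar>)" "integrable M (\<lambda>x. 2 * \<bar>g x\<bar>)"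
    "integrable M (\<lambda>x. 4 * \<bar>f x * g x\<bar>)"
    using i fg by auto
  note lim = integral_dominated_convergence[OF _ _ w(1), of f s]
    integral_dominated_convergence[OF _ _ w(2), of g t]
    integral_dominated_convergence[OF _ _ w(3), of "\<lambda>x. f x * g x" "\<lambda>n x. s n x * t n x"]
  note int = integrable_dominated_convergence2[OF _ _ w(1), of f s]
    integrable_dominated_convergence2[OF _ _ w(2), of g t]
    integrable_dominated_convergence2[OF _ _ w(3), of "\<lambda>x. f x * g x" "\<lambda>n x. s n x * t n x"]
  have L: "(\<lambda>n. expectation (s n)) \<longlonglongrightarrow> expectation f" "(\<lambda>n. expectation (t n)) \<longlonglongrightarrow> expectation g"
    "(\<lambda>n. expectation (\<lambda>x. s n x * t n x)) \<longlonglongrightarrow> expectation (\<lambda>x. f x * g x)"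
    using s t st by (auto intro!: lim tendsto_mult AE_I2)
  have "integrable M (s n)" "integrable M (t n)" "integrable M (\<lambda>x. s n x * t n x)" for n
    using s t st by (auto intro!: int tendsto_mult AE_I2)
  then have "covariance M (s n) (t n) =
      expectation (\<lambda>x. s n x * t n x) - expectation (s n) * expectation (t n)" for n
    by (intro covariance_eq_expectation)
  then show ?thesis
    using covariance_eq_expectation[OF i fg] by (simp add: L tendsto_diff tendsto_mult)
qed

lemma covariance_square_integrable_le:
  assumes sub: "subalgebra M F" "subalgebra M G" and \<epsilon>: "0 \<le> \<epsilon>" "\<epsilon> \<le> 1"
    and dep: "\<And>A B. A \<in> sets F \<Longrightarrow> B \<in> sets G \<Longrightarrow>
           prob (A \<inter> B) - prob A * prob B
             \<le> \<epsilon> * sqrt (prob A * (1 - prob A) * prob B * (1 - prob B))"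
    and f: "f \<in> borel_measurable F" "integrable M (\<lambda>x. (f x)\<^sup>2)"
    and g: "g \<in> borel_measurable G" "integrable M (\<lambda>x. (g x)\<^sup>2)"
  shows "2 * covariance M f g \<le> Lambda \<epsilon> * (covariance M f f + covariance M g g)"
proof -
  have sp: "space F = space M" "space G = space M"
    using sub by (auto simp: subalgebra_def)
  \<comment> \<open>Approximating with base point 0 turns the distance bound into the domination by
    \<open>2 * \<bar>f x\<bar>\<close>. The \<open>s n\<close> are simple over \<open>F\<close>, so
    the dependence hypothesis still applies to their level sets.\<close>
  obtain s where s: "\<And>n. simple_function F (s n)" "\<And>x. x \<in> space M \<Longrightarrow> (\<lambda>n. s n x) \<longlonglongrightarrow> f x"
    "\<And>n x. x \<in> space M \<Longrightarrow> \<bar>s n x\<bar> \<le> 2 * \<bar>f x\<bar>"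
    using borel_measurable_implies_sequence_metric[OF f(1), of 0] unfolding sp dist_real_def diff_0_right by metis
  obtain t where t: "\<And>n. simple_function G (t n)" "\<And>x. x \<in> space M \<Longrightarrow> (\<lambda>n. t n x) \<longlonglongrightarrow> g x"
    "\<And>n x. x \<in> space M \<Longrightarrow> \<bar>t n x\<bar> \<le> 2 * \<bar>g x\<bar>"
    using borel_measurable_implies_sequence_metric[OF g(1), of 0] unfolding sp dist_real_def diff_0_right by metis
  have meas: "f \<in> borel_measurable M" "g \<in> borel_measurable M"
    "s n \<in> borel_measurable M" "t n \<in> borel_measurable M" for n
    using f g sub borel_measurable_simple_function[OF s(1), of n] borel_measurable_simple_function[OF t(1), of n]
    by (auto intro: measurable_from_subalg)
  have "(\<lambda>n. 2 * covariance M (s n) (t n)) \<longlonglongrightarrow> 2 * covariance M f g"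
    by (intro tendsto_intros covariance_tendsto meas f g s t)
  moreover have "(\<lambda>n. Lambda \<epsilon> * (covariance M (s n) (s n) + covariance M (t n) (t n)))
      \<longlonglongrightarrow> Lambda \<epsilon> * (covariance M f f + covariance M g g)"
    by (intro tendsto_intros covariance_tendsto meas f g s t)
  moreover have "2 * covariance M (s n) (t n) \<le>
      Lambda \<epsilon> * (covariance M (s n) (s n) + covariance M (t n) (t n))" for n
    using sub \<epsilon> dep s(1) t(1) by (rule covariance_simple_le)
  ultimately show ?thesis
    by (meson LIMSEQ_le)
qed

end

section \<open>Normalisation and the supremum\<close>

lemma covariance_scale: "covariance M (\<lambda>x. a * f x) (\<lambda>x. b * g x) = a * b * covariance M f g"
proof -
  have "(a * f x - a * u) * (b * g x - b * v) = (a * b) * ((f x - u) * (g x - v))" for x u v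
    by (simp add: algebra_simps)
  then show ?thesis
    by (simp add: covariance_def)
qed

lemma covariance_self: "covariance M f f = (std_dev M f)\<^sup>2"
  by (simp add: covariance_def std_dev_def power2_eq_square[symmetric])

theorem theorem2p2p1:
  fixes M F G :: "'a measure" and \<epsilon> :: real
  assumes "prob_space M"
    and "subalgebra M F"
    and "subalgebra M G"
    and "\<epsilon> \<in> {0..1}"
    and "\<And>A B. A \<in> sets F \<Longrightarrow> B \<in> sets G \<Longrightarrow>
           measure M (A \<inter> B) - measure M A * measure M B
             \<le> \<epsilon> * sqrt (measure M A * (1 - measure M A) * measure M B * (1 - measure M B))"
  shows "maximal_correlation M F G \<le> Lambda \<epsilon>"
proof -
  interpret prob_space M by fact
  have \<epsilon>: "0 \<le> \<epsilon>" "\<epsilon> \<le> 1"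
    using assms(4) by auto
  have Lambda: "0 \<le> Lambda \<epsilon>"
    by (simp add: Lambda_def)
  have "r \<le> Lambda \<epsilon>" if rcv: "r \<in> correlation_values M F G" for r
  proof -
    obtain f g where r: "r = \<bar>covariance M f g\<bar> / (std_dev M f * std_dev M g)"
      and f: "f \<in> borel_measurable F" "integrable M (\<lambda>x. (f x)\<^sup>2)"
      and g: "g \<in> borel_measurable G" "integrable M (\<lambda>x. (g x)\<^sup>2)"
      using rcv unfolding correlation_values_def nonconst_L2_def by blast
    define a where "a = std_dev M f"
    define b where "b = std_dev M g"
    show ?thesis
    proof (cases "a = 0 \<or> b = 0")
      \<comment> \<open>The quotient is then 0 by the convention \<open>x / 0 = 0\<close>.\<close>
      case True
      then show ?thesis
        using r Lambda by (auto simp: a_def b_def)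
    next
      case False
      then have ab: "0 < a" "0 < b"
        by (auto simp: a_def b_def std_dev_def less_le)
      \<comment> \<open>Dividing by \<open>a\<close> and \<open>b\<close> makes the variances at
        most 1 (0 for \<open>u = 0\<close>). The sign goes into \<open>f\<close>, because the bound
        on the covariance is one-sided while the correlation takes its absolute value.\<close>
      define u where "u = sgn (covariance M f g) / a"
      define v where "v = 1 / b"
      have "2 * covariance M (\<lambda>x. u * f x) (\<lambda>x. v * g x) \<le>
        Lambda \<epsilon> * (covariance M (\<lambda>x. u * f x) (\<lambda>x. u * f x) + covariance M (\<lambda>x. v * g x) (\<lambda>x. v * g x))"
        using f g by (intro covariance_square_integrable_le[OF assms(2,3) \<epsilon> assms(5)])
          (auto simp: power_mult_distrib)
      then have "2 * (u * v * covariance M f g) \<le> Lambda \<epsilon> * (u * u * a\<^sup>2 + v * v * b\<^sup>2)"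
        by (simp only: covariance_scale covariance_self a_def b_def)
      also have "\<dots> \<le> Lambda \<epsilon> * 2"
        using Lambda ab by (intro mult_left_mono) (auto simp: u_def v_def power2_eq_square sgn_if)
      finally have "u * v * covariance M f g \<le> Lambda \<epsilon>"
        by simp
      moreover have "u * v * covariance M f g = r"
        by (simp add: r u_def v_def a_def b_def abs_sgn mult_ac)
      ultimately show ?thesis by simp
    qed
  qed
  \<comment> \<open>A trivial algebra gives the value 0; otherwise the set of values is nonempty, as
    a bound on the real \<open>Sup\<close> requires.\<close>
  then show ?thesis
    using Lambda correlation_values_nonempty[OF assms(1-3)]
    by (auto simp: maximal_correlation_def intro!: cSup_least)
qed

end
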